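(* Let $n\ge 1$ be an integer. Then $D_n(1,x)$ is a complete permutation polynomial over $\mathbb{Z}_3$ if and only if $n\equiv 2\pmod 8$ or $n\equiv 6\pmod 8$.
   Context: The $n$th reversed Dickson polynomial of the first kind (with parameter $1$) is the integer-coefficient polynomial $D_n(1,x)$ defined by $D_0(1,x)=2$, $D_1(1,x)=1$, $D_n(1,x)=D_{n-1}(1,x)-x\,D_{n-2}(1,x)$ for $n\ge 2$. A polynomial $f$ is a permutation polynomial over $\mathbb{Z}_3=\mathbb{F}_3$ if the map it induces $\mathbb{Z}_3\to\mathbb{Z}_3$ is a bijection, and a complete permutation polynomial if both $f(x)$ and $f(x)+x$ are permutation polynomials over $\mathbb{Z}_3$. *)

theory Defs
  imports
    "HOL-Library.Numeral_Type"
    "HOL-Computational_Algebra.Polynomial"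
    "HOL-Number_Theory.Cong"
begin

fun reversed_dickson :: "nat \<Rightarrow> int poly" where
  "reversed_dickson 0 = 2"
| "reversed_dickson (Suc 0) = 1"
| "reversed_dickson (Suc (Suc n)) = reversed_dickson (Suc n) - [:0, 1:] * reversed_dickson n"

definition permutation_poly :: "'a::{finite, comm_ring_1} poly \<Rightarrow> bool" where
  "permutation_poly f \<longleftrightarrow> bij (poly f)"

definition complete_permutation_poly :: "'a::{finite, comm_ring_1} poly \<Rightarrow> bool" where
  "complete_permutation_poly f \<longleftrightarrow> permutation_poly f \<and> permutation_poly (f + [:0, 1:])"

text \<open>
  The numeral type \<^typ>\<open>3\<close> has three elements and arithmetic modulo 3, so it is the ring of
  integers modulo 3; an integer polynomial is reduced to it coefficientwise.
\<close>

definition reduce_mod_3 :: "int poly \<Rightarrow> 3 poly" where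
  "reduce_mod_3 f = map_poly of_int f"

end

theory Submission
  imports Defs
begin

text \<open>
  A self-map of the three-element ring is decided by its values at \<open>0\<close>, \<open>1\<close> and \<open>-1\<close>, and at a fixed
  point \<open>x\<close> the sequence \<open>D\<^sub>n(1,x)\<close> satisfies the linear recurrence with characteristic polynomial
  \<open>t\<^sup>2 - t + x\<close>. Modulo 3 this polynomial is \<open>t (t - 1)\<close> at \<open>x = 0\<close>, so the value there is \<open>1\<close> for
  \<open>n \<ge> 1\<close>. At \<open>x = 1\<close> it is \<open>(t + 1)\<^sup>2\<close>, and the value is \<open>2 (-1)\<^sup>n\<close>. At \<open>x = -1\<close> it is irreducible
  with roots satisfying \<open>t\<^sup>4 = -1\<close>, so the value changes sign under \<open>n \<mapsto> n + 4\<close>; its first four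
  terms are \<open>-1, 1, 0, 1\<close>, so it vanishes exactly when \<open>n mod 4 = 2\<close>.

  Hence odd \<open>n\<close> is excluded by a collision between \<open>0\<close> and \<open>1\<close>. For even \<open>n\<close> the values at \<open>0\<close> and
  \<open>1\<close> are \<open>1\<close> and \<open>2\<close>, so \<open>D\<^sub>n(1,x)\<close> permutes the ring exactly when it vanishes at \<open>-1\<close>. In
  that case it is the map \<open>x \<mapsto> x + 1\<close>, and adding \<open>x\<close> gives \<open>x \<mapsto> 1 - x\<close>, which is again
  a permutation. So permutation and complete permutation coincide here, and the residues 2 and 6
  modulo 8 together say \<open>n mod 4 = 2\<close>.
\<close>

lemma three_eq_zero: "(3 :: 3) = 0"
  by simp

lemma three_exhaust: "x = 0 \<or> x = 1 \<or> x = -1" for x :: 3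
proof (cases x rule: bit1_cases)
  case (of_int z)
  then have "z = 0 \<or> z = 1 \<or> z = 2" by auto
  moreover have "(2 :: 3) = -1"
    using three_eq_zero by (simp add: eq_neg_iff_add_eq_0)
  ultimately show ?thesis using of_int by auto
qed

lemma three_neg_facts: "(2 :: 3) = -1" "(1 :: 3) \<noteq> -1"
  using three_eq_zero by (simp_all add: eq_neg_iff_add_eq_0)

lemma three_all_iff: "(\<forall>x :: 3. P x) \<longleftrightarrow> P 0 \<and> P 1 \<and> P (-1)"
  using three_exhaust by metis

lemma bij_three_iff:
  fixes f :: "3 \<Rightarrow> 3"
  shows "bij f \<longleftrightarrow> f 0 \<noteq> f 1 \<and> f 0 \<noteq> f (-1) \<and> f 1 \<noteq> f (-1)"
proof -
  have "bij f \<longleftrightarrow> inj f"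
    using finite_UNIV_inj_surj[of f] by (auto simp: bij_def)
  also have "\<dots> \<longleftrightarrow> f 0 \<noteq> f 1 \<and> f 0 \<noteq> f (-1) \<and> f 1 \<noteq> f (-1)"
    using three_neg_facts(2) unfolding inj_def three_all_iff by auto
  finally show ?thesis .
qed

abbreviation dickson3 :: "nat \<Rightarrow> 3 \<Rightarrow> 3" where
  "dickson3 n \<equiv> poly (reduce_mod_3 (reversed_dickson n))"

text \<open>
  Reduction modulo 3 is compatible with differences and with multiplication by the variable, so the
  recursion for the polynomials becomes a linear recurrence for their values at each point. From
  here on the values are computed by this recurrence only.
\<close>

lemma dickson3_simps:
  "dickson3 0 x = -1"
  "dickson3 (Suc 0) x = 1"
  "dickson3 (Suc (Suc n)) x = dickson3 (Suc n) x - x * dickson3 n x"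
proof -
  have "reduce_mod_3 2 = [:2:]" "reduce_mod_3 1 = [:1:]"
    unfolding reduce_mod_3_def by (simp_all add: numeral_poly map_poly_pCons one_pCons)
  then show "dickson3 0 x = -1" "dickson3 (Suc 0) x = 1"
    by (simp_all add: three_neg_facts)
  have "reduce_mod_3 (p - [:0, 1:] * q) = reduce_mod_3 p - [:0, 1:] * reduce_mod_3 q" for p q
    unfolding reduce_mod_3_def by (rule poly_eqI) (simp add: coeff_map_poly coeff_pCons split: nat.splits)
  then show "dickson3 (Suc (Suc n)) x = dickson3 (Suc n) x - x * dickson3 n x"
    by simp
qed

declare reversed_dickson.simps [simp del]

lemma dickson3_at_0: "dickson3 (Suc n) 0 = 1"
  by (induction n) (simp_all add: dickson3_simps)

text \<open>
  The double root \<open>-1\<close> could contribute a term \<open>n (-1)\<^sup>n\<close>, but the initial values \<open>-1\<close> and \<open>1\<close>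
  already fit a pure geometric sequence.
\<close>

lemma dickson3_at_1: "dickson3 n 1 = - ((-1) ^ n)"
proof (induction n rule: reversed_dickson.induct)
  case (3 n)
  \<comment> \<open>The two sides of the recurrence differ by a multiple of this term.\<close>
  have "(3 :: 3) * (-1) ^ n = 0" by (simp only: three_eq_zero) simp
  with 3 show ?case by (simp add: dickson3_simps three_neg_facts)
qed (simp_all add: dickson3_simps)

text \<open>
  At \<open>-1\<close> the recurrence is that of the Fibonacci and Lucas numbers, so four steps give
  \<open>3 D\<^sub>n\<^sub>+\<^sub>1 + 2 D\<^sub>n\<close>, which is \<open>-D\<^sub>n\<close> modulo 3.
\<close>

lemma dickson3_at_minus_1_add_4: "dickson3 (n + 4) (-1) = - dickson3 n (-1)"
proof -
  have "dickson3 (n + 4) (-1) + dickson3 n (-1)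
      = 3 * dickson3 (Suc n) (-1) + 3 * dickson3 n (-1)"
    by (simp add: dickson3_simps numeral_eq_Suc algebra_simps)
  then show ?thesis by (simp add: three_eq_zero eq_neg_iff_add_eq_0)
qed

lemma dickson3_at_minus_1_eq_0_iff: "dickson3 n (-1) = 0 \<longleftrightarrow> n mod 4 = 2"
proof (induction n rule: less_induct)
  case (less n)
  show ?case
  proof (cases "n < 4")
    case True
    then consider "n = 0" | "n = Suc 0" | "n = Suc (Suc 0)" | "n = Suc (Suc (Suc 0))" by linarith
    then show ?thesis
      by cases (simp_all add: dickson3_simps)
  next
    case False
    then obtain m where "n = m + 4" using le_Suc_ex[of 4 n] by (auto simp: add.commute)
    with less.IH[of m] show ?thesis by (simp add: dickson3_at_minus_1_add_4)
  qed
qed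

theorem theorem3p23:
  fixes n :: nat
  assumes "n \<ge> 1"
  shows "complete_permutation_poly (reduce_mod_3 (reversed_dickson n)) \<longleftrightarrow>
           [n = 2] (mod 8) \<or> [n = 6] (mod 8)"
proof -
  let ?P = "reduce_mod_3 (reversed_dickson n)"
  have at_0: "dickson3 n 0 = 1"
    using assms dickson3_at_0[of "n - 1"] by simp
  have residues: "[n = 2] (mod 8) \<or> [n = 6] (mod 8) \<longleftrightarrow> n mod 4 = 2"
    unfolding cong_def by (simp, presburger)
  show ?thesis
  proof (cases "even n")
    case True
    then have at_1: "dickson3 n 1 = -1" by (simp add: dickson3_at_1)
    have "permutation_poly ?P \<longleftrightarrow> dickson3 n (-1) = 0"
      using three_exhaust[of "dickson3 n (-1)"] three_neg_facts
      unfolding permutation_poly_def bij_three_iff at_0 at_1 by auto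
    moreover have "permutation_poly (?P + [:0, 1:])" if "dickson3 n (-1) = 0"
      using that three_neg_facts
      by (simp add: permutation_poly_def bij_three_iff at_0 at_1)
    ultimately show ?thesis
      unfolding complete_permutation_poly_def residues dickson3_at_minus_1_eq_0_iff by blast
  next
    case False
    then have "dickson3 n 1 = dickson3 n 0" by (simp add: dickson3_at_1 at_0)
    moreover have "n mod 4 \<noteq> 2" using False by presburger
    ultimately show ?thesis
      unfolding complete_permutation_poly_def permutation_poly_def bij_three_iff residues by simp
  qed
qed

end
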